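(* For all integers $m\ge 0$, the Padovan hyperbolic spinors $\psi_n$ and the Perrin hyperbolic spinors $\phi_n$ satisfy: (a) $$\sum_{n=0}^m\psi_n=\psi_{m+5}-\psi_4=\begin{bmatrix}P_{m+5}+P_{m+8}j\\ -P_{m+6}+P_{m+7}j\end{bmatrix}-\begin{bmatrix}2+5j\\ -3+4j\end{bmatrix},$$ $$\sum_{n=0}^m\phi_n=\phi_{m+5}-\phi_4=\begin{bmatrix}R_{m+5}+R_{m+8}j\\ -R_{m+6}+R_{m+7}j\end{bmatrix}-\begin{bmatrix}2+7j\\ -5+5j\end{bmatrix};$$ (b) $$\sum_{n=0}^m\psi_{2n}=\psi_{2m+3}-\psi_1=\begin{bmatrix}P_{2m+3}+P_{2m+6}j\\ -P_{2m+4}+P_{2m+5}j\end{bmatrix}-\begin{bmatrix}1+2j\\ -1+2j\end{bmatrix},$$ $$\sum_{n=0}^m\phi_{2n}=\phi_{2m+3}-\phi_1=\begin{bmatrix}R_{2m+3}+R_{2m+6}j\\ -R_{2m+4}+R_{2m+5}j\end{bmatrix}-\begin{bmatrix}2j\\ -2+3j\end{bmatrix};$$ (c) $$\sum_{n=0}^m\psi_{2n+1}=\psi_{2m+4}-\psi_2=\begin{bmatrix}P_{2m+4}+P_{2m+7}j\\ -P_{2m+5}+P_{2m+6}j\end{bmatrix}-\begin{bmatrix}1+3j\\ -2+2j\end{bmatrix},$$ $$\sum_{n=0}^m\phi_{2n+1}=\phi_{2m+4}-\phi_2=\begin{bmatrix}R_{2m+4}+R_{2m+7}j\\ -R_{2m+5}+R_{2m+6}j\end{bmatrix}-\begin{bmatrix}2+5j\\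 -3+2j\end{bmatrix}.$$
   Context: Hyperbolic numbers are expressions $a+bj$ with $a,b\in\mathbb{R}$ and a unit $j\notin\mathbb{R}$, $j^2=1$; they form a commutative ring. A hyperbolic spinor is a column vector with two hyperbolic number components, with componentwise addition and scalar multiplication. The Padovan numbers $(P_n)_{n\ge 0}$ are defined by $P_0=P_1=P_2=1$ and $P_{n+3}=P_{n+1}+P_n$ for $n\ge0$. The Perrin numbers $(R_n)_{n\ge 0}$ are defined by $R_0=3$, $R_1=0$, $R_2=2$ and $R_{n+3}=R_{n+1}+R_n$ for $n\ge 0$. The $n$-th Padovan hyperbolic spinor and the $n$-th Perrin hyperbolic spinor are $$\psi_n=\begin{bmatrix}P_n+P_{n+3}j\\ -P_{n+1}+P_{n+2}j\end{bmatrix},\qquad \phi_n=\begin{bmatrix}R_n+R_{n+3}j\\ -R_{n+1}+R_{n+2}j\end{bmatrix}.$$ *)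

theory Defs
  imports "HOL-Analysis.Analysis"
begin

text \<open>Hyperbolic numbers, set up in the same way as the library's complex numbers;
  \<^term>\<open>Hyp a b\<close> stands for \<open>a + b j\<close>.\<close>

codatatype hyperbolic = Hyp (rpart: real) (jpart: real)

lemma hyperbolic_eq_iff: "x = y \<longleftrightarrow> rpart x = rpart y \<and> jpart x = jpart y"
  by (auto intro: hyperbolic.expand)

instantiation hyperbolic :: comm_ring_1
begin

primcorec zero_hyperbolic where
  "rpart 0 = 0"
| "jpart 0 = 0"

primcorec one_hyperbolic where
  "rpart 1 = 1"
| "jpart 1 = 0"

primcorec plus_hyperbolic where
  "rpart (x + y) = rpart x + rpart y"
| "jpart (x + y) = jpart x + jpart y"

primcorec uminus_hyperbolic where
  "rpart (- x) = - rpart x"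
| "jpart (- x) = - jpart x"

primcorec minus_hyperbolic where
  "rpart (x - y) = rpart x - rpart y"
| "jpart (x - y) = jpart x - jpart y"

primcorec times_hyperbolic where
  "rpart (x * y) = rpart x * rpart y + jpart x * jpart y"
| "jpart (x * y) = rpart x * jpart y + jpart x * rpart y"

instance
  by standard (simp_all add: hyperbolic_eq_iff algebra_simps)

end

instantiation hyperbolic :: real_algebra_1
begin

primcorec scaleR_hyperbolic where
  "rpart (scaleR r x) = r * rpart x"
| "jpart (scaleR r x) = r * jpart x"

instance
  by standard (simp_all add: hyperbolic_eq_iff algebra_simps)

end

primcorec hyp_j :: hyperbolic where
  "rpart hyp_j = 0"
| "jpart hyp_j = 1"

lemma hyp_j_square: "hyp_j ^ 2 = 1"
  by (simp add: hyperbolic_eq_iff power2_eq_square)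

lemma hyp_j_not_real: "hyp_j \<notin> \<real>"
  by (auto simp: Reals_def of_real_def hyperbolic_eq_iff)

lemma Hyp_eq: "Hyp a b = of_real a + of_real b * hyp_j"
  by (simp add: hyperbolic_eq_iff of_real_def)

text \<open>Vector addition, and scalar multiplication \<open>*s\<close>, are the library's componentwise operations.\<close>

type_synonym hyperbolic_spinor = "hyperbolic ^ 2"

fun padovan :: "nat \<Rightarrow> nat" where
  "padovan 0 = 1"
| "padovan (Suc 0) = 1"
| "padovan (Suc (Suc 0)) = 1"
| "padovan (Suc (Suc (Suc n))) = padovan (Suc n) + padovan n"

fun perrin :: "nat \<Rightarrow> nat" where
  "perrin 0 = 3"
| "perrin (Suc 0) = 0"
| "perrin (Suc (Suc 0)) = 2"
| "perrin (Suc (Suc (Suc n))) = perrin (Suc n) + perrin n"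

definition padovan_spinor :: "nat \<Rightarrow> hyperbolic_spinor" where
  "padovan_spinor n = vector
     [of_nat (padovan n) + of_nat (padovan (n + 3)) * hyp_j,
      - of_nat (padovan (n + 1)) + of_nat (padovan (n + 2)) * hyp_j]"

definition perrin_spinor :: "nat \<Rightarrow> hyperbolic_spinor" where
  "perrin_spinor n = vector
     [of_nat (perrin n) + of_nat (perrin (n + 3)) * hyp_j,
      - of_nat (perrin (n + 1)) + of_nat (perrin (n + 2)) * hyp_j]"

end

theory Submission
  imports Defs
begin

text \<open>Both spinor sequences inherit the recurrence \<open>f (n + 3) = f (n + 1) + f n\<close>.
  It makes the sums over even and odd indices telescope, and it implies
  \<open>f (n + 5) = f (n + 4) + f n\<close>, which makes the full sum telescope.\<close>

context
  fixes f :: "nat \<Rightarrow> 'a::ab_group_add"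
  assumes rec: "\<And>n. f (n + 3) = f (n + 1) + f n"
begin

lemma padovan_rec_sum: "(\<Sum>n=0..m. f n) = f (m + 5) - f 4"
proof -
  \<comment> \<open>Expanding \<open>f (n + 5)\<close> gives \<open>f (n + 3) + f (n + 2)\<close>,
    and then \<open>(f (n + 1) + f n) + f (n + 2)\<close>. The outer two terms combine to
    \<open>f (n + 4)\<close>.\<close>
  have step: "f (n + 5) = f (n + 4) + f n" for n
    using rec[of "n + 2"] rec[of "n + 1"] rec[of n] by (simp add: eval_nat_numeral algebra_simps)
  show ?thesis
  proof (induction m)
    case 0
    show ?case using step[of 0] by simp
  next
    case (Suc m)
    then show ?case using step[of "Suc m"] by (simp add: eval_nat_numeral)
  qed
qed

text \<open>Each summand is a difference of consecutive odd-indexed terms,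
  \<open>f (2 * n) = f (2 * n + 3) - f (2 * n + 1)\<close>, so only the two ends survive.\<close>

lemma padovan_rec_sum_even: "(\<Sum>n=0..m. f (2 * n)) = f (2 * m + 3) - f 1"
proof (induction m)
  case 0
  show ?case using rec[of 0] by simp
next
  case (Suc m)
  then show ?case using rec[of "2 * Suc m"] by (simp add: eval_nat_numeral)
qed

text \<open>The same telescoping shifted by one: \<open>f (2 * n + 1)\<close> is the difference of
  the consecutive even-indexed terms \<open>f (2 * n + 4)\<close> and
  \<open>f (2 * n + 2)\<close>.\<close>

lemma padovan_rec_sum_odd: "(\<Sum>n=0..m. f (2 * n + 1)) = f (2 * m + 4) - f 2"
proof (induction m)
  case 0
  show ?case using rec[of 1] by (simp add: eval_nat_numeral)
next
  case (Suc m)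
  then show ?case using rec[of "2 * Suc m + 1"] by (simp add: eval_nat_numeral)
qed

end

text \<open>Each component is a fixed linear combination, over the hyperbolic numbers, of shifted
  Padovan numbers, so the linear recurrence carries over. This makes the three abstract sums
  applicable to spinors.\<close>

lemma padovan_spinor_rec: "padovan_spinor (n + 3) = padovan_spinor (n + 1) + padovan_spinor n"
  by (simp add: padovan_spinor_def vec_eq_iff forall_2 eval_nat_numeral algebra_simps)

lemma perrin_spinor_rec: "perrin_spinor (n + 3) = perrin_spinor (n + 1) + perrin_spinor n"
  by (simp add: perrin_spinor_def vec_eq_iff forall_2 eval_nat_numeral algebra_simps)

text \<open>These are the terms left at the lower end of the telescoped sums, evaluated from the
  Padovan numbers up to index 7.\<close>

lemma padovan_spinor_initial:
  "padovan_spinor 1 = vector [1 + 2 * hyp_j, - 1 + 2 * hyp_j]"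
  "padovan_spinor 2 = vector [1 + 3 * hyp_j, - 2 + 2 * hyp_j]"
  "padovan_spinor 4 = vector [2 + 5 * hyp_j, - 3 + 4 * hyp_j]"
  by (simp_all add: padovan_spinor_def eval_nat_numeral)

lemma perrin_spinor_initial:
  "perrin_spinor 1 = vector [2 * hyp_j, - 2 + 3 * hyp_j]"
  "perrin_spinor 2 = vector [2 + 5 * hyp_j, - 3 + 2 * hyp_j]"
  "perrin_spinor 4 = vector [2 + 7 * hyp_j, - 5 + 5 * hyp_j]"
  by (simp_all add: perrin_spinor_def eval_nat_numeral)

theorem theorem18:
  fixes m :: nat
  shows "(\<Sum>n=0..m. padovan_spinor n) = padovan_spinor (m + 5) - padovan_spinor 4 \<and>
    padovan_spinor (m + 5) - padovan_spinor 4 =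
          vector [of_nat (padovan (m + 5)) + of_nat (padovan (m + 8)) * hyp_j,
             - of_nat (padovan (m + 6)) + of_nat (padovan (m + 7)) * hyp_j]
          - vector [2 + 5 * hyp_j,
                    - 3 + 4 * hyp_j] \<and>
    (\<Sum>n=0..m. perrin_spinor n) = perrin_spinor (m + 5) - perrin_spinor 4 \<and>
    perrin_spinor (m + 5) - perrin_spinor 4 =
          vector [of_nat (perrin (m + 5)) + of_nat (perrin (m + 8)) * hyp_j,
             - of_nat (perrin (m + 6)) + of_nat (perrin (m + 7)) * hyp_j]
          - vector [2 + 7 * hyp_j,
                    - 5 + 5 * hyp_j] \<and>
    (\<Sum>n=0..m. padovan_spinor (2 * n)) = padovan_spinor (2 * m + 3) - padovan_spinor 1 \<and>
    padovan_spinor (2 * m + 3) - padovan_spinor 1 =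
          vector [of_nat (padovan (2 * m + 3)) + of_nat (padovan (2 * m + 6)) * hyp_j,
             - of_nat (padovan (2 * m + 4)) + of_nat (padovan (2 * m + 5)) * hyp_j]
          - vector [1 + 2 * hyp_j,
                    - 1 + 2 * hyp_j] \<and>
    (\<Sum>n=0..m. perrin_spinor (2 * n)) = perrin_spinor (2 * m + 3) - perrin_spinor 1 \<and>
    perrin_spinor (2 * m + 3) - perrin_spinor 1 =
          vector [of_nat (perrin (2 * m + 3)) + of_nat (perrin (2 * m + 6)) * hyp_j,
             - of_nat (perrin (2 * m + 4)) + of_nat (perrin (2 * m + 5)) * hyp_j]
          - vector [2 * hyp_j,
                    - 2 + 3 * hyp_j] \<and>
    (\<Sum>n=0..m. padovan_spinor (2 * n + 1)) = padovan_spinor (2 * m + 4) - padovan_spinor 2 \<and>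
    padovan_spinor (2 * m + 4) - padovan_spinor 2 =
          vector [of_nat (padovan (2 * m + 4)) + of_nat (padovan (2 * m + 7)) * hyp_j,
             - of_nat (padovan (2 * m + 5)) + of_nat (padovan (2 * m + 6)) * hyp_j]
          - vector [1 + 3 * hyp_j,
                    - 2 + 2 * hyp_j] \<and>
    (\<Sum>n=0..m. perrin_spinor (2 * n + 1)) = perrin_spinor (2 * m + 4) - perrin_spinor 2 \<and>
    perrin_spinor (2 * m + 4) - perrin_spinor 2 =
          vector [of_nat (perrin (2 * m + 4)) + of_nat (perrin (2 * m + 7)) * hyp_j,
             - of_nat (perrin (2 * m + 5)) + of_nat (perrin (2 * m + 6)) * hyp_j]
          - vector [2 + 5 * hyp_j,
                    - 3 + 2 * hyp_j]"
  \<comment> \<open>Once the sums are replaced by their closed forms, the summation equations are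
    trivial. In the explicit ones the subtracted vectors agree, and the rest is the spinor
    definition with indices such as \<open>2 * m + 3 + 3\<close> normalised.\<close>
  unfolding padovan_rec_sum[OF padovan_spinor_rec] padovan_rec_sum[OF perrin_spinor_rec]
    padovan_rec_sum_even[OF padovan_spinor_rec] padovan_rec_sum_even[OF perrin_spinor_rec]
    padovan_rec_sum_odd[OF padovan_spinor_rec] padovan_rec_sum_odd[OF perrin_spinor_rec]
    padovan_spinor_initial perrin_spinor_initial
  by (simp add: padovan_spinor_def perrin_spinor_def ac_simps)

end
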